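(* Let $X_n$ be a finite Dynkin diagram (one of $A_n,B_n,C_n,D_n,E_6,E_7,E_8,F_4,G_2$) with poset of positive roots $(\Phi_+,\le)$, and let $p$ be an antichain of $(\Phi_+,\le)$. Then in the ring $H_{X_n}$ one has $$h_p=\sum_{p\preceq q}\delta_q,$$ where the sum is over all antichains $q$ of $(\Phi_+,\le)$ such that $p\preceq q$.
   Context: $\Phi_+$ is the set of positive roots of the (irreducible, reduced, crystallographic) root system of type $X_n$, with the partial order $\alpha\le\beta$ iff $\beta-\alpha$ has non-negative coefficients in the basis of simple roots. Roots are regarded as linear forms on a real vector space $V$ of dimension $n$ (the simple roots form a basis of $V^*$). An antichain is a (possibly empty) set of pairwise incomparable elements of $\Phi_+$. For an antichain $p$, $I_p$ denotes the upper ideal of $(\Phi_+,\le)$ generated by $p$. Antichains are partially ordered by $p\preceq q$ iff $I_p\subseteq I_q$. The Shi arrangement is the collection of hyperplanes $\alpha(x)=0$ and $\alpha(x)=1$, $\alpha\in\Phi_+$; the dominant Weyl chamber is $\{x:\alpha(x)>0\ \forall\alpha\in\Phi_+\}$. Dominant regions are the connected components of the complement of the union of the Shi hyperplanes contained in the dominant chamber. It is known that antichains are in bijection with dominant regions: $p$ corresponds to the region defined by $\alpha(x)>1$ for $\alpha\in I_p$ and $0<\alpha(x)<1$ for $\alpha\in\Phi_+\setminus I_p$. $H_{X_n}$ is the ring (pointwise operations) of locally constant integer-valued functions on the union of the dominant regions. For an antichain $p$, $\delta_p\in H_{X_n}$ is the function equal to $1$ on the region corresponding to $p$ and $0$ elsewhere.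 For $\alpha\in\Phi_+$, $h_\alpha\in H_{X_n}$ is the function with $h_\alpha(x)=1$ if $\alpha(x)>1$ and $h_\alpha(x)=0$ if $\alpha(x)<1$. For an antichain $p=\{\alpha_1,\dots,\alpha_k\}$, $h_p=h_{\alpha_1}\cdots h_{\alpha_k}$ (with $h_\emptyset=1$). *)

theory Defs
  imports "HOL-Analysis.Analysis" "HOL-Algebra.Ring"
begin

section \<open>Dynkin types\<close>

datatype dynkin_type = A nat | B nat | C nat | D nat | E6 | E7 | E8 | F4 | G2

fun rank :: "dynkin_type \<Rightarrow> nat" where
  "rank (A n) = n" | "rank (B n) = n" | "rank (C n) = n" | "rank (D n) = n"
| "rank E6 = 6" | "rank E7 = 7" | "rank E8 = 8" | "rank F4 = 4" | "rank G2 = 2"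

fun valid_type :: "dynkin_type \<Rightarrow> bool" where
  "valid_type (A n) \<longleftrightarrow> 1 \<le> n"
| "valid_type (B n) \<longleftrightarrow> 2 \<le> n"
| "valid_type (C n) \<longleftrightarrow> 2 \<le> n"
| "valid_type (D n) \<longleftrightarrow> 4 \<le> n"
| "valid_type _ \<longleftrightarrow> True"

text \<open>Nodes are numbered \<open>1, \<dots>, rank X\<close> as in Bourbaki. The edges \<open>{i, j}\<close>, with
  multiplicities forgotten, are listed with \<open>i < j\<close>.\<close>

fun edges :: "dynkin_type \<Rightarrow> (nat \<times> nat) set" where
  "edges (D n) = {(i, i + 1) | i. 1 \<le> i \<and> i + 1 < n} \<union> {(n - 2, n)}"
| "edges E6 = {(1,3), (2,4), (3,4), (4,5), (5,6)}"
| "edges E7 = {(1,3), (2,4), (3,4), (4,5), (5,6), (6,7)}"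
| "edges E8 = {(1,3), (2,4), (3,4), (4,5), (5,6), (6,7), (7,8)}"
| "edges X = {(i, i + 1) | i. 1 \<le> i \<and> i < rank X}"

text \<open>\<open>abs_cartan X i j\<close> is the absolute value of the Cartan integer
  \<open>\<langle>\<alpha>\<^sub>i, \<alpha>\<^sub>j\<^sup>\<or>\<rangle>\<close> of two adjacent nodes; it exceeds 1 exactly when \<open>\<alpha>\<^sub>i\<close> is longer
  than \<open>\<alpha>\<^sub>j\<close>. The short simple roots are \<open>\<alpha>\<^sub>n\<close> in \<open>B\<^sub>n\<close>; \<open>\<alpha>\<^sub>1, \<dots>, \<alpha>\<^sub>n\<^sub>-\<^sub>1\<close> in \<open>C\<^sub>n\<close>;
  \<open>\<alpha>\<^sub>3, \<alpha>\<^sub>4\<close> in \<open>F\<^sub>4\<close>; \<open>\<alpha>\<^sub>1\<close> in \<open>G\<^sub>2\<close>.\<close>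

fun abs_cartan :: "dynkin_type \<Rightarrow> nat \<Rightarrow> nat \<Rightarrow> int" where
  "abs_cartan (B n) i j = (if i + 1 = n \<and> j = n then 2 else 1)"
| "abs_cartan (C n) i j = (if i = n \<and> j + 1 = n then 2 else 1)"
| "abs_cartan F4 i j = (if i = 2 \<and> j = 3 then 2 else 1)"
| "abs_cartan G2 i j = (if i = 2 \<and> j = 1 then 3 else 1)"
| "abs_cartan _ i j = 1"

definition cartan_matrix :: "dynkin_type \<Rightarrow> nat \<Rightarrow> nat \<Rightarrow> int" where
  "cartan_matrix X i j =
     (if i = j then 2
      else if (i, j) \<in> edges X \<or> (j, i) \<in> edges X then - abs_cartan X i j
      else 0)"


section \<open>Root systems in the dual space\<close>

text \<open>The ambient space \<open>V\<close> is a type \<open>'v :: euclidean_space\<close>, of which only the linear and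
  topological structure is used. Since every linear form on \<open>V\<close> is bounded, the dual space
  \<open>V\<^sup>*\<close> is the type \<open>'v \<Rightarrow>\<^sub>L real\<close>. Coroots are elements of \<open>V\<close>. The dimension of \<open>V\<close> is not
  a separate parameter: the simple roots form a basis of \<open>V\<^sup>*\<close>.\<close>

type_synonym 'v dual = "'v \<Rightarrow>\<^sub>L real"

definition is_coroot :: "'v::euclidean_space dual set \<Rightarrow> 'v dual \<Rightarrow> 'v \<Rightarrow> bool" where
  "is_coroot \<Phi> \<alpha> v \<longleftrightarrow>
     blinfun_apply \<alpha> v = 2 \<and> (\<forall>\<beta>\<in>\<Phi>. \<beta> - blinfun_apply \<beta> v *\<^sub>R \<alpha> \<in> \<Phi>)"

text \<open>In a finite spanning set \<open>\<Phi>\<close> a root has at most one coroot, so the description below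
  is proper as soon as a coroot exists.\<close>

definition coroot :: "'v::euclidean_space dual set \<Rightarrow> 'v dual \<Rightarrow> 'v" where
  "coroot \<Phi> \<alpha> = (THE v. is_coroot \<Phi> \<alpha> v)"

text \<open>Reduced crystallographic root systems.\<close>

definition root_system :: "'v::euclidean_space dual set \<Rightarrow> bool" where
  "root_system \<Phi> \<longleftrightarrow>
     finite \<Phi> \<and> span \<Phi> = UNIV \<and>
     (\<forall>\<alpha>\<in>\<Phi>. \<exists>v. is_coroot \<Phi> \<alpha> v) \<and>
     (\<forall>\<alpha>\<in>\<Phi>. \<forall>\<beta>\<in>\<Phi>. blinfun_apply \<beta> (coroot \<Phi> \<alpha>) \<in> \<int>) \<and>
     (\<forall>\<alpha>\<in>\<Phi>. \<forall>c. c *\<^sub>R \<alpha> \<in> \<Phi> \<longrightarrow> c = 1 \<or> c = - 1)"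

text \<open>\<open>S\<close> is a set of simple roots (a base) of \<open>\<Phi>\<close>.\<close>

definition simple_roots :: "'v::euclidean_space dual set \<Rightarrow> 'v dual set \<Rightarrow> bool" where
  "simple_roots \<Phi> S \<longleftrightarrow>
     S \<subseteq> \<Phi> \<and> independent S \<and> span S = UNIV \<and>
     (\<forall>\<beta>\<in>\<Phi>. \<exists>k :: 'v dual \<Rightarrow> int.
        \<beta> = (\<Sum>\<sigma>\<in>S. of_int (k \<sigma>) *\<^sub>R \<sigma>) \<and> ((\<forall>\<sigma>\<in>S. 0 \<le> k \<sigma>) \<or> (\<forall>\<sigma>\<in>S. k \<sigma> \<le> 0)))"

text \<open>Irreducibility is not listed: it is the connectedness of the diagram \<open>X\<close>.\<close>

definition root_system_of_type ::
  "dynkin_type \<Rightarrow> 'v::euclidean_space dual set \<Rightarrow> 'v dual set \<Rightarrow> bool" where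
  "root_system_of_type X \<Phi> S \<longleftrightarrow>
     root_system \<Phi> \<and> simple_roots \<Phi> S \<and>
     (\<exists>a. bij_betw a {1..rank X} S \<and>
        (\<forall>i\<in>{1..rank X}. \<forall>j\<in>{1..rank X}.
           blinfun_apply (a i) (coroot \<Phi> (a j)) = of_int (cartan_matrix X i j)))"


section \<open>The poset of positive roots and its antichains\<close>

definition nonneg_comb :: "'v::euclidean_space dual set \<Rightarrow> 'v dual \<Rightarrow> bool" where
  "nonneg_comb S \<phi> \<longleftrightarrow>
     (\<exists>c :: 'v dual \<Rightarrow> real. (\<forall>\<sigma>\<in>S. 0 \<le> c \<sigma>) \<and> \<phi> = (\<Sum>\<sigma>\<in>S. c \<sigma> *\<^sub>R \<sigma>))"

definition pos_roots :: "'v::euclidean_space dual set \<Rightarrow> 'v dual set \<Rightarrow> 'v dual set" where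
  "pos_roots \<Phi> S = {\<beta> \<in> \<Phi>. nonneg_comb S \<beta>}"

definition root_le :: "'v::euclidean_space dual set \<Rightarrow> 'v dual \<Rightarrow> 'v dual \<Rightarrow> bool" where
  "root_le S \<alpha> \<beta> \<longleftrightarrow> nonneg_comb S (\<beta> - \<alpha>)"

definition antichain ::
  "'v::euclidean_space dual set \<Rightarrow> 'v dual set \<Rightarrow> 'v dual set \<Rightarrow> bool" where
  "antichain \<Phi> S p \<longleftrightarrow>
     p \<subseteq> pos_roots \<Phi> S \<and> (\<forall>\<alpha>\<in>p. \<forall>\<beta>\<in>p. root_le S \<alpha> \<beta> \<longrightarrow> \<alpha> = \<beta>)"

definition upper_ideal ::
  "'v::euclidean_space dual set \<Rightarrow> 'v dual set \<Rightarrow> 'v dual set \<Rightarrow> 'v dual set" where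
  "upper_ideal \<Phi> S p = {\<beta> \<in> pos_roots \<Phi> S. \<exists>\<alpha>\<in>p. root_le S \<alpha> \<beta>}"

definition antichain_le ::
  "'v::euclidean_space dual set \<Rightarrow> 'v dual set \<Rightarrow> 'v dual set \<Rightarrow> 'v dual set \<Rightarrow> bool" where
  "antichain_le \<Phi> S p q \<longleftrightarrow> upper_ideal \<Phi> S p \<subseteq> upper_ideal \<Phi> S q"


section \<open>Dominant regions of the Shi arrangement\<close>

definition shi_arrangement ::
  "'v::euclidean_space dual set \<Rightarrow> 'v dual set \<Rightarrow> 'v set set" where
  "shi_arrangement \<Phi> S =
     (\<Union>\<alpha>\<in>pos_roots \<Phi> S. {{x. blinfun_apply \<alpha> x = 0}, {x. blinfun_apply \<alpha> x = 1}})"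

definition dominant_chamber ::
  "'v::euclidean_space dual set \<Rightarrow> 'v dual set \<Rightarrow> 'v set" where
  "dominant_chamber \<Phi> S = {x. \<forall>\<alpha>\<in>pos_roots \<Phi> S. 0 < blinfun_apply \<alpha> x}"

definition dominant_regions ::
  "'v::euclidean_space dual set \<Rightarrow> 'v dual set \<Rightarrow> 'v set set" where
  "dominant_regions \<Phi> S =
     {R \<in> components (- \<Union>(shi_arrangement \<Phi> S)). R \<subseteq> dominant_chamber \<Phi> S}"

definition region_of ::
  "'v::euclidean_space dual set \<Rightarrow> 'v dual set \<Rightarrow> 'v dual set \<Rightarrow> 'v set" where
  "region_of \<Phi> S p =
     {x. (\<forall>\<alpha>\<in>upper_ideal \<Phi> S p. 1 < blinfun_apply \<alpha> x) \<and>
         (\<forall>\<alpha>\<in>pos_roots \<Phi> S - upper_ideal \<Phi> S p.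
            0 < blinfun_apply \<alpha> x \<and> blinfun_apply \<alpha> x < 1)}"


section \<open>The ring of locally constant functions\<close>

text \<open>Functions on \<open>U\<close> are the extensional ones: they take the value \<open>undefined\<close> off \<open>U\<close>,
  so equality in the ring is equality of functions on \<open>U\<close>.\<close>

definition locally_constant_ring :: "'v::topological_space set \<Rightarrow> ('v \<Rightarrow> int) ring" where
  "locally_constant_ring U =
     \<lparr>carrier = {f \<in> extensional U.
        \<forall>x\<in>U. \<exists>T. openin (top_of_set U) T \<and> x \<in> T \<and> f constant_on T},
      monoid.mult = (\<lambda>f g. \<lambda>x\<in>U. f x * g x),
      one = (\<lambda>x\<in>U. 1),
      zero = (\<lambda>x\<in>U. 0),
      add = (\<lambda>f g. \<lambda>x\<in>U. f x + g x)\<rparr>"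

definition H_ring ::
  "'v::euclidean_space dual set \<Rightarrow> 'v dual set \<Rightarrow> ('v \<Rightarrow> int) ring" where
  "H_ring \<Phi> S = locally_constant_ring (\<Union>(dominant_regions \<Phi> S))"

definition delta ::
  "'v::euclidean_space dual set \<Rightarrow> 'v dual set \<Rightarrow> 'v dual set \<Rightarrow> 'v \<Rightarrow> int" where
  "delta \<Phi> S p = (\<lambda>x\<in>\<Union>(dominant_regions \<Phi> S). if x \<in> region_of \<Phi> S p then 1 else 0)"

text \<open>No point of a dominant region satisfies \<open>\<alpha>(x) = 1\<close>, so the second branch is
  \<open>\<alpha>(x) < 1\<close>.\<close>

definition heaviside ::
  "'v::euclidean_space dual set \<Rightarrow> 'v dual set \<Rightarrow> 'v dual \<Rightarrow> 'v \<Rightarrow> int" where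
  "heaviside \<Phi> S \<alpha> = (\<lambda>x\<in>\<Union>(dominant_regions \<Phi> S). if 1 < blinfun_apply \<alpha> x then 1 else 0)"

definition heaviside_antichain ::
  "'v::euclidean_space dual set \<Rightarrow> 'v dual set \<Rightarrow> 'v dual set \<Rightarrow> 'v \<Rightarrow> int" where
  "heaviside_antichain \<Phi> S p = (\<Otimes>\<^bsub>H_ring \<Phi> S\<^esub>\<alpha>\<in>p. heaviside \<Phi> S \<alpha>)"

end

theory Submission
  imports Defs
begin

text \<open>A point \<open>x\<close> of a dominant region determines the upper ideal
  \<open>J = {\<alpha>. \<alpha>(x) > 1}\<close>, and \<open>x\<close> lies in the region of an antichain \<open>q\<close> iff \<open>q\<close> generates \<open>J\<close>,
  that is, iff \<open>q\<close> is the set of minimal elements of \<open>J\<close>. So at \<open>x\<close> the right-hand side counts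
  one antichain if the ideal generated by \<open>p\<close> lies in \<open>J\<close> and none otherwise, while the left-hand
  side is 1 if \<open>p \<subseteq> J\<close> and 0 otherwise; the two conditions agree because \<open>J\<close> is an upper ideal.\<close>

section \<open>The ring of locally constant functions\<close>

lemma locally_constant_ring_simps:
  "one (locally_constant_ring U) = (\<lambda>x\<in>U. 1)"
  "zero (locally_constant_ring U) = (\<lambda>x\<in>U. 0)"
  "monoid.mult (locally_constant_ring U) f g = (\<lambda>x\<in>U. f x * g x)"
  "add (locally_constant_ring U) f g = (\<lambda>x\<in>U. f x + g x)"
  by (simp_all add: locally_constant_ring_def)

lemma locally_constant_ringI:
  assumes "f \<in> extensional U"
    and "\<And>x. x \<in> U \<Longrightarrow> \<exists>T. openin (top_of_set U) T \<and> x \<in> T \<and> (\<forall>y\<in>T. f y = f x)"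
  shows "f \<in> carrier (locally_constant_ring U)"
  using assms unfolding locally_constant_ring_def constant_on_def by simp blast

lemma locally_constant_ringD:
  assumes "f \<in> carrier (locally_constant_ring U)" "x \<in> U"
  shows "\<exists>T. openin (top_of_set U) T \<and> x \<in> T \<and> (\<forall>y\<in>T. f y = f x)"
  using assms unfolding locally_constant_ring_def constant_on_def by simp metis

lemma locally_constant_ring_extensional:
  "f \<in> carrier (locally_constant_ring U) \<Longrightarrow> f \<in> extensional U"
  by (simp add: locally_constant_ring_def)

lemma locally_constant_ring_const: "(\<lambda>x\<in>U. c) \<in> carrier (locally_constant_ring U)"
  by (rule locally_constant_ringI) (auto intro!: exI[of _ U])

text \<open>On the intersection of a neighbourhood where \<open>f\<close> is constant with one where
  \<open>g\<close> is, every pointwise combination of the two is constant. As \<open>F\<close> is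
  arbitrary, this covers sums, products and negation.\<close>

lemma locally_constant_ring_binop:
  assumes f: "f \<in> carrier (locally_constant_ring U)" and g: "g \<in> carrier (locally_constant_ring U)"
  shows "(\<lambda>x\<in>U. F (f x) (g x)) \<in> carrier (locally_constant_ring U)"
proof (rule locally_constant_ringI)
  fix x assume x: "x \<in> U"
  obtain T T' where T: "openin (top_of_set U) T" "x \<in> T" "\<forall>y\<in>T. f y = f x"
    and T': "openin (top_of_set U) T'" "x \<in> T'" "\<forall>y\<in>T'. g y = g x"
    using locally_constant_ringD[OF f x] locally_constant_ringD[OF g x] by blast
  have "openin (top_of_set U) (T \<inter> T')" using T(1) T'(1) by (rule openin_Int)
  moreover have "T \<subseteq> U" using openin_subset[OF T(1)] by simp
  then have "(\<lambda>x\<in>U. F (f x) (g x)) y = (\<lambda>x\<in>U. F (f x) (g x)) x" if "y \<in> T \<inter> T'" for y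
    using T(3) T'(3) x that by (simp add: subset_iff)
  ultimately show "\<exists>T. openin (top_of_set U) T \<and> x \<in> T \<and>
      (\<forall>y\<in>T. (\<lambda>x\<in>U. F (f x) (g x)) y = (\<lambda>x\<in>U. F (f x) (g x)) x)"
    using T(2) T'(2) by blast
qed simp

text \<open>The ring laws allow finite products and sums in this structure to be unfolded one factor
  or term at a time, and hence to be evaluated pointwise.\<close>

lemma cring_locally_constant_ring: "cring (locally_constant_ring U)"
proof (rule cringI)
  let ?R = "locally_constant_ring U"
  note [simp] = locally_constant_ring_simps
  show "abelian_group ?R"
  proof (rule abelian_groupI)
    fix f assume f: "f \<in> carrier ?R"
    show "\<exists>g\<in>carrier ?R. g \<oplus>\<^bsub>?R\<^esub> f = \<zero>\<^bsub>?R\<^esub>"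
      using locally_constant_ring_binop[OF f f, of "\<lambda>a b. - a"]
      by (intro bexI[of _ "\<lambda>x\<in>U. - f x"]) (auto intro!: ext)
    show "\<zero>\<^bsub>?R\<^esub> \<oplus>\<^bsub>?R\<^esub> f = f"
      using locally_constant_ring_extensional[OF f]
      by (auto intro!: ext simp: restrict_def extensional_def)
  qed (auto intro!: ext simp: locally_constant_ring_binop locally_constant_ring_const ac_simps)
  show "comm_monoid ?R"
  proof (rule comm_monoidI)
    fix f assume f: "f \<in> carrier ?R"
    show "\<one>\<^bsub>?R\<^esub> \<otimes>\<^bsub>?R\<^esub> f = f"
      using locally_constant_ring_extensional[OF f]
      by (auto intro!: ext simp: restrict_def extensional_def)
  qed (auto intro!: ext simp: locally_constant_ring_binop locally_constant_ring_const ac_simps)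
qed (auto intro!: ext simp: locally_constant_ring_simps algebra_simps)

lemma finprod_locally_constant_ring:
  assumes "finite I" "f \<in> I \<rightarrow> carrier (locally_constant_ring U)"
  shows "finprod (locally_constant_ring U) f I = (\<lambda>x\<in>U. \<Prod>i\<in>I. f i x)"
proof -
  interpret cring "locally_constant_ring U" by (rule cring_locally_constant_ring)
  show ?thesis using assms
    by (induction I rule: finite_induct)
      (auto intro!: ext simp: locally_constant_ring_simps Pi_iff)
qed

lemma finsum_locally_constant_ring:
  assumes "finite I" "f \<in> I \<rightarrow> carrier (locally_constant_ring U)"
  shows "finsum (locally_constant_ring U) f I = (\<lambda>x\<in>U. \<Sum>i\<in>I. f i x)"
proof -
  interpret cring "locally_constant_ring U" by (rule cring_locally_constant_ring)
  show ?thesis using assms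
    by (induction I rule: finite_induct)
      (auto intro!: ext simp: locally_constant_ring_simps Pi_iff)
qed

section \<open>The ideal of a point\<close>

lemma nonneg_comb_add:
  assumes "nonneg_comb S \<phi>" "nonneg_comb S \<psi>"
  shows "nonneg_comb S (\<phi> + \<psi>)"
proof -
  obtain c d where "\<forall>\<sigma>\<in>S. 0 \<le> c \<sigma>" "\<phi> = (\<Sum>\<sigma>\<in>S. c \<sigma> *\<^sub>R \<sigma>)"
    "\<forall>\<sigma>\<in>S. 0 \<le> d \<sigma>" "\<psi> = (\<Sum>\<sigma>\<in>S. d \<sigma> *\<^sub>R \<sigma>)"
    using assms unfolding nonneg_comb_def by auto
  then show ?thesis unfolding nonneg_comb_def
    by (intro exI[of _ "\<lambda>\<sigma>. c \<sigma> + d \<sigma>"]) (simp add: scaleR_add_left sum.distrib)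
qed

lemma root_le_refl: "root_le S \<alpha> \<alpha>"
  unfolding root_le_def nonneg_comb_def by (intro exI[of _ "\<lambda>_. 0"]) simp

lemma root_le_trans: "root_le S \<alpha> \<beta> \<Longrightarrow> root_le S \<beta> \<gamma> \<Longrightarrow> root_le S \<alpha> \<gamma>"
  unfolding root_le_def using nonneg_comb_add[of S "\<beta> - \<alpha>" "\<gamma> - \<beta>"] by simp

text \<open>Take coefficient 1 at the root itself and 0 elsewhere. Dominance is stated for positive
  roots; this makes it available for simple ones.\<close>

lemma simple_subset_pos_roots:
  assumes "finite S" "S \<subseteq> \<Phi>"
  shows "S \<subseteq> pos_roots \<Phi> S"
proof
  fix \<sigma> assume "\<sigma> \<in> S"
  moreover have "(\<Sum>\<tau>\<in>S. (if \<tau> = \<sigma> then 1 else 0) *\<^sub>R \<tau>) = (\<Sum>\<tau>\<in>S. if \<tau> = \<sigma> then \<tau> else 0)"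
    by (rule sum.cong) auto
  ultimately have "nonneg_comb S \<sigma>" unfolding nonneg_comb_def
    using assms(1) by (intro exI[of _ "\<lambda>\<tau>. if \<tau> = \<sigma> then 1 else 0"]) (simp add: sum.delta)
  then show "\<sigma> \<in> pos_roots \<Phi> S"
    using \<open>\<sigma> \<in> S\<close> assms(2) by (auto simp: pos_roots_def)
qed

text \<open>The difference \<open>\<beta> - \<alpha>\<close> is a non-negative combination of simple
  roots, each positive at \<open>x\<close>, and being nonzero it has a nonzero coefficient. From
  this come the antisymmetry of the order, the upward closure of \<open>ideal_at\<close> and the
  existence of minimal elements.\<close>

lemma root_le_dominant_less:
  assumes S: "finite S" "S \<subseteq> \<Phi>" and x: "x \<in> dominant_chamber \<Phi> S"
    and le: "root_le S \<alpha> \<beta>" and ne: "\<alpha> \<noteq> \<beta>"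
  shows "blinfun_apply \<alpha> x < blinfun_apply \<beta> x"
proof -
  obtain c where c: "\<forall>\<sigma>\<in>S. 0 \<le> c \<sigma>" "\<beta> - \<alpha> = (\<Sum>\<sigma>\<in>S. c \<sigma> *\<^sub>R \<sigma>)"
    using le unfolding root_le_def nonneg_comb_def by auto
  have pos: "0 < blinfun_apply \<sigma> x" if "\<sigma> \<in> S" for \<sigma>
    using x simple_subset_pos_roots[OF S] that by (auto simp: dominant_chamber_def)
  obtain \<tau> where \<tau>: "\<tau> \<in> S" "c \<tau> \<noteq> 0"
    using c(2) ne by (metis (no_types, lifting) eq_iff_diff_eq_0 scale_eq_0_iff sum.neutral)
  have "0 < (\<Sum>\<sigma>\<in>S. c \<sigma> * blinfun_apply \<sigma> x)"
  proof (rule sum_pos2[OF S(1) \<tau>(1)])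
    show "0 < c \<tau> * blinfun_apply \<tau> x" using c(1) pos \<tau> by (simp add: order_less_le)
    show "0 \<le> c \<sigma> * blinfun_apply \<sigma> x" if "\<sigma> \<in> S" for \<sigma>
      using c(1) pos[OF that] that by simp
  qed
  also have "\<dots> = blinfun_apply (\<beta> - \<alpha>) x"
    unfolding c(2) by (simp add: blinfun.sum_left blinfun.scaleR_left)
  finally show ?thesis by (simp add: blinfun.diff_left)
qed

definition ideal_at ::
  "'v::euclidean_space dual set \<Rightarrow> 'v dual set \<Rightarrow> 'v \<Rightarrow> 'v dual set" where
  "ideal_at \<Phi> S x = {\<alpha> \<in> pos_roots \<Phi> S. 1 < blinfun_apply \<alpha> x}"

definition minimal_at ::
  "'v::euclidean_space dual set \<Rightarrow> 'v dual set \<Rightarrow> 'v \<Rightarrow> 'v dual set" where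
  "minimal_at \<Phi> S x =
     {\<alpha> \<in> ideal_at \<Phi> S x. \<forall>\<beta>\<in>ideal_at \<Phi> S x. root_le S \<beta> \<alpha> \<longrightarrow> \<beta> = \<alpha>}"

section \<open>The unique antichain whose region contains a given point\<close>

lemma dominant_region_pointD:
  assumes "x \<in> \<Union>(dominant_regions \<Phi> S)"
  shows "x \<in> dominant_chamber \<Phi> S"
    and "\<alpha> \<in> pos_roots \<Phi> S \<Longrightarrow> blinfun_apply \<alpha> x \<noteq> 1"
proof -
  obtain R where R: "R \<in> components (- \<Union>(shi_arrangement \<Phi> S))"
    "R \<subseteq> dominant_chamber \<Phi> S" "x \<in> R"
    using assms by (auto simp: dominant_regions_def)
  show "x \<in> dominant_chamber \<Phi> S" using R by blast
  have "x \<notin> \<Union>(shi_arrangement \<Phi> S)" using in_components_subset[OF R(1)] R(3) by blast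
  then show "\<alpha> \<in> pos_roots \<Phi> S \<Longrightarrow> blinfun_apply \<alpha> x \<noteq> 1"
    by (auto simp: shi_arrangement_def)
qed

text \<open>At \<open>x\<close> every positive root is positive and different from 1, so each lies
  either in (0,1) or above 1. The inequalities defining the region thus say which roots exceed 1 at
  \<open>x\<close>.\<close>

lemma region_of_iff_upper_ideal_eq:
  assumes x: "x \<in> \<Union>(dominant_regions \<Phi> S)"
  shows "x \<in> region_of \<Phi> S q \<longleftrightarrow> upper_ideal \<Phi> S q = ideal_at \<Phi> S x"
proof -
  have "upper_ideal \<Phi> S q \<subseteq> pos_roots \<Phi> S" by (auto simp: upper_ideal_def)
  moreover have "0 < blinfun_apply \<alpha> x \<and> (blinfun_apply \<alpha> x < 1 \<longleftrightarrow> \<not> 1 < blinfun_apply \<alpha> x)"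
    if "\<alpha> \<in> pos_roots \<Phi> S" for \<alpha>
    using dominant_region_pointD[OF x] that by (force simp: dominant_chamber_def)
  ultimately show ?thesis unfolding region_of_def ideal_at_def by blast
qed

text \<open>Forwards, \<open>p\<close> lies in the ideal it generates. Backwards, values at
  \<open>x\<close> grow along the order, so exceeding 1 passes from \<open>p\<close> to everything
  above it.\<close>

lemma upper_ideal_subset_ideal_at_iff:
  assumes S: "finite S" "S \<subseteq> \<Phi>" and x: "x \<in> dominant_chamber \<Phi> S"
    and p: "p \<subseteq> pos_roots \<Phi> S"
  shows "upper_ideal \<Phi> S p \<subseteq> ideal_at \<Phi> S x \<longleftrightarrow> (\<forall>\<alpha>\<in>p. 1 < blinfun_apply \<alpha> x)"
proof
  assume "upper_ideal \<Phi> S p \<subseteq> ideal_at \<Phi> S x"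
  moreover have "p \<subseteq> upper_ideal \<Phi> S p"
    using p root_le_refl by (auto simp: upper_ideal_def)
  ultimately show "\<forall>\<alpha>\<in>p. 1 < blinfun_apply \<alpha> x" by (auto simp: ideal_at_def)
next
  assume 1: "\<forall>\<alpha>\<in>p. 1 < blinfun_apply \<alpha> x"
  show "upper_ideal \<Phi> S p \<subseteq> ideal_at \<Phi> S x"
  proof
    fix \<beta> assume "\<beta> \<in> upper_ideal \<Phi> S p"
    then obtain \<alpha> where \<alpha>: "\<beta> \<in> pos_roots \<Phi> S" "\<alpha> \<in> p" "root_le S \<alpha> \<beta>"
      by (auto simp: upper_ideal_def)
    then show "\<beta> \<in> ideal_at \<Phi> S x"
      using 1 root_le_dominant_less[OF S x \<alpha>(3)] by (force simp: ideal_at_def)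
  qed
qed

lemma antichain_minimal_at: "antichain \<Phi> S (minimal_at \<Phi> S x)"
  unfolding antichain_def minimal_at_def ideal_at_def by auto

text \<open>The existence half: since there are finitely many roots, every root of the ideal lies
  above a minimal one.\<close>

lemma upper_ideal_minimal_at:
  assumes fin: "finite \<Phi>" and S: "finite S" "S \<subseteq> \<Phi>" and x: "x \<in> dominant_chamber \<Phi> S"
  shows "upper_ideal \<Phi> S (minimal_at \<Phi> S x) = ideal_at \<Phi> S x"
proof
  have "minimal_at \<Phi> S x \<subseteq> pos_roots \<Phi> S" "\<forall>\<alpha>\<in>minimal_at \<Phi> S x. 1 < blinfun_apply \<alpha> x"
    by (auto simp: minimal_at_def ideal_at_def)
  then show "upper_ideal \<Phi> S (minimal_at \<Phi> S x) \<subseteq> ideal_at \<Phi> S x"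
    using upper_ideal_subset_ideal_at_iff[OF S x] by blast
next
  show "ideal_at \<Phi> S x \<subseteq> upper_ideal \<Phi> S (minimal_at \<Phi> S x)"
  proof
    fix \<beta> assume \<beta>: "\<beta> \<in> ideal_at \<Phi> S x"
    let ?B = "{\<alpha> \<in> ideal_at \<Phi> S x. root_le S \<alpha> \<beta>}"
    have B: "finite ?B" "?B \<noteq> {}"
      using fin \<beta> root_le_refl by (auto simp: ideal_at_def pos_roots_def)
    \<comment> \<open>a root below \<open>\<beta>\<close> with the least value at \<open>x\<close> is minimal, as \<open>x\<close> is strictly monotone on roots\<close>
    define \<alpha> where "\<alpha> = arg_min_on (\<lambda>\<alpha>. blinfun_apply \<alpha> x) ?B"
    have \<alpha>: "\<alpha> \<in> ?B"
      unfolding \<alpha>_def by (rule arg_min_if_finite(1)[OF B])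
    have least: "blinfun_apply \<alpha> x \<le> blinfun_apply \<gamma> x" if "\<gamma> \<in> ?B" for \<gamma>
      unfolding \<alpha>_def by (rule arg_min_least[OF B that])
    have "\<gamma> = \<alpha>" if \<gamma>: "\<gamma> \<in> ideal_at \<Phi> S x" "root_le S \<gamma> \<alpha>" for \<gamma>
    proof (rule ccontr)
      assume "\<gamma> \<noteq> \<alpha>"
      then have "blinfun_apply \<gamma> x < blinfun_apply \<alpha> x"
        using root_le_dominant_less[OF S x \<gamma>(2)] by simp
      moreover have "\<gamma> \<in> ?B" using \<alpha> \<gamma> root_le_trans by blast
      ultimately show False using least by force
    qed
    then have "\<alpha> \<in> minimal_at \<Phi> S x" using \<alpha> by (auto simp: minimal_at_def)
    then show "\<beta> \<in> upper_ideal \<Phi> S (minimal_at \<Phi> S x)"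
      using \<alpha> \<beta> by (auto simp: upper_ideal_def ideal_at_def)
  qed
qed

text \<open>The uniqueness half: every root of the ideal lies above some element of
  \<open>q\<close>. Hence nothing in the ideal lies strictly below an element of \<open>q\<close>,
  and a minimal root equals the element of \<open>q\<close> below it.\<close>

lemma antichain_eq_minimal_at:
  assumes S: "finite S" "S \<subseteq> \<Phi>" and x: "x \<in> dominant_chamber \<Phi> S"
    and q: "antichain \<Phi> S q" and J: "upper_ideal \<Phi> S q = ideal_at \<Phi> S x"
  shows "q = minimal_at \<Phi> S x"
proof -
  \<comment> \<open>Distinct roots comparable both ways would have values at \<open>x\<close>
    strictly ordered both ways.\<close>
  have antisym: "\<alpha> = \<beta>" if "root_le S \<alpha> \<beta>" "root_le S \<beta> \<alpha>" for \<alpha> \<beta>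
    using root_le_dominant_less[OF S x that(1)] root_le_dominant_less[OF S x that(2)] by force
  have sub: "q \<subseteq> ideal_at \<Phi> S x"
    unfolding J[symmetric] using q root_le_refl by (auto simp: antichain_def upper_ideal_def)
  have gen: "\<exists>\<alpha>\<in>q. root_le S \<alpha> \<beta>" if "\<beta> \<in> ideal_at \<Phi> S x" for \<beta>
    using that unfolding J[symmetric] by (auto simp: upper_ideal_def)
  have "\<beta> = \<alpha>" if "\<alpha> \<in> q" "\<beta> \<in> ideal_at \<Phi> S x" "root_le S \<beta> \<alpha>" for \<alpha> \<beta>
  proof -
    obtain \<gamma> where \<gamma>: "\<gamma> \<in> q" "root_le S \<gamma> \<beta>" using gen \<open>\<beta> \<in> ideal_at \<Phi> S x\<close> by blast
    \<comment> \<open>Here \<gamma> \<le> \<beta> \<le> \<alpha> with both ends in the antichain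
      \<open>q\<close>, so the chain collapses.\<close>
    then have "\<gamma> = \<alpha>" using q that root_le_trans unfolding antichain_def by blast
    then show ?thesis using antisym \<gamma> that by blast
  qed
  then have "q \<subseteq> minimal_at \<Phi> S x" using sub by (auto simp: minimal_at_def)
  moreover have "minimal_at \<Phi> S x \<subseteq> q"
  proof
    fix \<alpha> assume \<alpha>: "\<alpha> \<in> minimal_at \<Phi> S x"
    then obtain \<gamma> where "\<gamma> \<in> q" "root_le S \<gamma> \<alpha>" using gen by (auto simp: minimal_at_def)
    then show "\<alpha> \<in> q" using \<alpha> sub by (auto simp: minimal_at_def)
  qed
  ultimately show ?thesis by blast
qed

lemma region_of_iff_eq_minimal_at:
  assumes "finite \<Phi>" "finite S" "S \<subseteq> \<Phi>" "x \<in> \<Union>(dominant_regions \<Phi> S)" "antichain \<Phi> S q"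
  shows "x \<in> region_of \<Phi> S q \<longleftrightarrow> q = minimal_at \<Phi> S x"
  using assms dominant_region_pointD(1) region_of_iff_upper_ideal_eq upper_ideal_minimal_at
    antichain_eq_minimal_at by metis

section \<open>Local constancy of the functions involved\<close>

lemma ideal_at_locally_constant:
  fixes \<Phi> S :: "'v::euclidean_space dual set"
  assumes fin: "finite \<Phi>" and x: "x \<in> \<Union>(dominant_regions \<Phi> S)"
  shows "\<exists>T. openin (top_of_set (\<Union>(dominant_regions \<Phi> S))) T \<and> x \<in> T \<and>
    (\<forall>y\<in>T. ideal_at \<Phi> S y = ideal_at \<Phi> S x)"
proof -
  let ?U = "\<Union>(dominant_regions \<Phi> S)"
  \<comment> \<open>\<open>N \<alpha>\<close> is the open side of the hyperplane \<alpha> = 1 on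
    which \<open>x\<close> lies. On the finite intersection of these sides the same positive roots
    exceed 1.\<close>
  define N :: "'v dual \<Rightarrow> 'v set" where
    "N \<alpha> = (if 1 < blinfun_apply \<alpha> x then {y. 1 < blinfun_apply \<alpha> y}
            else {y. blinfun_apply \<alpha> y < 1})" for \<alpha>
  have "open (N \<alpha>)" for \<alpha>
    unfolding N_def
    by (auto intro!: open_Collect_less continuous_intros linear_continuous_on blinfun.bounded_linear_right)
  then have "open (\<Inter>\<alpha>\<in>pos_roots \<Phi> S. N \<alpha>)"
    using fin by (intro open_INT) (auto simp: pos_roots_def)
  moreover have "x \<in> (\<Inter>\<alpha>\<in>pos_roots \<Phi> S. N \<alpha>)"
    using dominant_region_pointD(2)[OF x] by (force simp: N_def)
  moreover have "ideal_at \<Phi> S y = ideal_at \<Phi> S x" if "y \<in> (\<Inter>\<alpha>\<in>pos_roots \<Phi> S. N \<alpha>)" for y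
  proof -
    have "1 < blinfun_apply \<alpha> y \<longleftrightarrow> 1 < blinfun_apply \<alpha> x" if "\<alpha> \<in> pos_roots \<Phi> S" for \<alpha>
    proof -
      have "y \<in> N \<alpha>" using \<open>y \<in> _\<close> that by blast
      then show ?thesis by (simp add: N_def split: if_splits)
    qed
    then show ?thesis by (auto simp: ideal_at_def)
  qed
  ultimately show ?thesis using x
    by (intro exI[of _ "?U \<inter> (\<Inter>\<alpha>\<in>pos_roots \<Phi> S. N \<alpha>)"] conjI openin_open_Int) blast+
qed

text \<open>A function of \<open>x\<close> that depends only on \<open>ideal_at \<Phi> S x\<close>
  inherits its local constancy. Both \<open>delta\<close> and \<open>heaviside\<close> at a positive
  root are of this kind.\<close>

lemma ideal_at_invariant_in_H_ring:
  assumes fin: "finite \<Phi>" and f: "f \<in> extensional (\<Union>(dominant_regions \<Phi> S))"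
    and inv: "\<And>x y. x \<in> \<Union>(dominant_regions \<Phi> S) \<Longrightarrow> y \<in> \<Union>(dominant_regions \<Phi> S) \<Longrightarrow>
      ideal_at \<Phi> S y = ideal_at \<Phi> S x \<Longrightarrow> f y = f x"
  shows "f \<in> carrier (H_ring \<Phi> S)"
  unfolding H_ring_def
proof (rule locally_constant_ringI[OF f])
  fix x assume x: "x \<in> \<Union>(dominant_regions \<Phi> S)"
  obtain T where T: "openin (top_of_set (\<Union>(dominant_regions \<Phi> S))) T" "x \<in> T"
    "\<forall>y\<in>T. ideal_at \<Phi> S y = ideal_at \<Phi> S x"
    using ideal_at_locally_constant[OF fin x] by blast
  have "T \<subseteq> \<Union>(dominant_regions \<Phi> S)" using openin_subset[OF T(1)] by simp
  then show "\<exists>T. openin (top_of_set (\<Union>(dominant_regions \<Phi> S))) T \<and> x \<in> T \<and> (\<forall>y\<in>T. f y = f x)"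
    using T inv[OF x] by (meson subsetD)
qed

lemma delta_in_H_ring: "finite \<Phi> \<Longrightarrow> delta \<Phi> S q \<in> carrier (H_ring \<Phi> S)"
  by (rule ideal_at_invariant_in_H_ring)
    (simp_all add: delta_def region_of_iff_upper_ideal_eq del: Union_iff)

lemma heaviside_in_H_ring:
  assumes "finite \<Phi>" "\<alpha> \<in> pos_roots \<Phi> S"
  shows "heaviside \<Phi> S \<alpha> \<in> carrier (H_ring \<Phi> S)"
proof (rule ideal_at_invariant_in_H_ring[OF assms(1)])
  fix x y assume "x \<in> \<Union>(dominant_regions \<Phi> S)" "y \<in> \<Union>(dominant_regions \<Phi> S)"
    and eq: "ideal_at \<Phi> S y = ideal_at \<Phi> S x"
  moreover have "1 < blinfun_apply \<alpha> y \<longleftrightarrow> 1 < blinfun_apply \<alpha> x"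
    using eq assms(2) by (auto simp: ideal_at_def)
  ultimately show "heaviside \<Phi> S \<alpha> y = heaviside \<Phi> S \<alpha> x"
    by (simp add: heaviside_def del: Union_iff)
qed (simp add: heaviside_def)

theorem proposition7p1:
  fixes X :: dynkin_type
    and \<Phi> S p :: "('v::euclidean_space \<Rightarrow>\<^sub>L real) set"
  assumes "valid_type X"
    and "root_system_of_type X \<Phi> S"
    and "antichain \<Phi> S p"
  shows "heaviside_antichain \<Phi> S p =
           (\<Oplus>\<^bsub>H_ring \<Phi> S\<^esub>q\<in>{q. antichain \<Phi> S q \<and> antichain_le \<Phi> S p q}. delta \<Phi> S q)"
proof -
  let ?U = "\<Union>(dominant_regions \<Phi> S)"
  let ?Q = "{q. antichain \<Phi> S q \<and> antichain_le \<Phi> S p q}"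
  have fin: "finite \<Phi>" and sub: "S \<subseteq> \<Phi>"
    using assms(2) unfolding root_system_of_type_def root_system_def simple_roots_def by blast+
  have finS: "finite S" using fin sub finite_subset by blast
  have p: "p \<subseteq> pos_roots \<Phi> S" using assms(3) by (simp add: antichain_def)
  have finp: "finite p" using p fin by (auto simp: pos_roots_def intro: finite_subset)
  \<comment> \<open>A ring sum over an infinite index set is zero by default, so the finiteness of
    \<open>?Q\<close> matters.\<close>
  have "?Q \<subseteq> Pow \<Phi>" by (auto simp: antichain_def pos_roots_def)
  then have finQ: "finite ?Q" using fin by (simp add: finite_subset)
  have "heaviside_antichain \<Phi> S p = (\<lambda>x\<in>?U. \<Prod>\<alpha>\<in>p. heaviside \<Phi> S \<alpha> x)"
    unfolding heaviside_antichain_def H_ring_def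
    using p heaviside_in_H_ring[OF fin] finp
    by (intro finprod_locally_constant_ring) (auto simp: H_ring_def)
  also have "\<dots> = (\<lambda>x\<in>?U. \<Sum>q\<in>?Q. delta \<Phi> S q x)"
  proof (rule restrict_ext)
    fix x assume x: "x \<in> ?U"
    note dom = dominant_region_pointD(1)[OF x]
    let ?m = "minimal_at \<Phi> S x"
    \<comment> \<open>At \<open>x\<close> only the antichain of minimal roots can contribute, so the
      sum has at most one nonzero term.\<close>
    have "(\<Sum>q\<in>?Q. delta \<Phi> S q x) = (\<Sum>q\<in>?Q. if q = ?m then 1 else 0)"
    proof (rule sum.cong[OF refl])
      fix q assume "q \<in> ?Q"
      then have "x \<in> region_of \<Phi> S q \<longleftrightarrow> q = ?m"
        using region_of_iff_eq_minimal_at[OF fin finS sub x] by blast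
      then show "delta \<Phi> S q x = (if q = ?m then 1 else 0)"
        using x by (simp add: delta_def del: Union_iff)
    qed
    \<comment> \<open>The term is present iff \<open>?m\<close> belongs to \<open>?Q\<close>; as
      \<open>?m\<close> is an antichain, only the comparison with \<open>p\<close> remains.\<close>
    also have "\<dots> = (if antichain_le \<Phi> S p ?m then 1 else 0)"
      using finQ antichain_minimal_at[of \<Phi> S x] by (simp add: sum.delta)
    also have "\<dots> = (if \<forall>\<alpha>\<in>p. 1 < blinfun_apply \<alpha> x then 1 else 0)"
      unfolding antichain_le_def upper_ideal_minimal_at[OF fin finS sub dom]
        upper_ideal_subset_ideal_at_iff[OF finS sub dom p] ..
    \<comment> \<open>A product of values 0 and 1 is 1 iff no factor vanishes. For empty
      \<open>p\<close> the vacuous condition matches the empty product.\<close>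
    also have "\<dots> = (\<Prod>\<alpha>\<in>p. if 1 < blinfun_apply \<alpha> x then 1 else 0)"
      using finp by (auto simp: prod_zero_iff)
    also have "\<dots> = (\<Prod>\<alpha>\<in>p. heaviside \<Phi> S \<alpha> x)"
      using x by (simp add: heaviside_def del: Union_iff)
    finally show "(\<Prod>\<alpha>\<in>p. heaviside \<Phi> S \<alpha> x) = (\<Sum>q\<in>?Q. delta \<Phi> S q x)" ..
  qed
  also have "\<dots> = (\<Oplus>\<^bsub>H_ring \<Phi> S\<^esub>q\<in>?Q. delta \<Phi> S q)"
    unfolding H_ring_def
    using delta_in_H_ring[OF fin] finQ
    by (intro finsum_locally_constant_ring[symmetric]) (auto simp: H_ring_def)
  finally show ?thesis .
qed

end
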